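(* Fix a wave number $k>0$ and $g>0$, and let $\sigma=0$, $h_\pm=\infty$. There exist parameters $\mu,x_2^*>0$ (independent of $\epsilon$), i.e. a profile $U\in C^{0,1}(\mathbb{R})$ with $U=0$ for $x_2<0$ and $$U(x_2)=U_+(x_2)=\begin{cases}\mu x_2,&0\le x_2\le x_2^*,\\ \mu x_2^*,&x_2>x_2^*,\end{cases}$$ that is unstable in the following sense: for all sufficiently small $\epsilon>0$ there exists $(y,c)$ solving $$-y''+\Big(\frac{U_+''}{U_+-c}+k^2\Big)y=0\text{ on }(0,\infty),\quad y(0)=1,\quad y(x_2)\to0\text{ as }x_2\to\infty,$$ $$g(1-\epsilon)=-\epsilon\,(U_+(0)-c)^2y'(0)+c^2k+\epsilon\,U_+'(0)\,(U_+(0)-c),$$ with $$0<\operatorname{Im}c=O(\sqrt{\epsilon}).$$ Moreover, for this profile, with $U_*:=U_+(x_2^* )=\mu x_2^*$, the quantity $U_*-\sqrt{g/k}$ has a positive lower bound uniform in $\epsilon$; hence the critical layer (the point where $U_+=\sqrt{g/k}$) occurs at an inflection point of $U$ (a point where $U_+''=0$) away from $x_2^*$.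
   Context: $\epsilon=\rho_+/\rho_->0$ is the ratio of air to water density. Since $U_+''=-\mu\,\delta_{x_2^*}$ is a Dirac mass, the ODE for $y$ is understood as: $y$ is continuous on $[0,\infty)$, satisfies $y''=k^2y$ on $(0,x_2^* )$ and $(x_2^*,\infty)$, and $y'(x_2^*+)-y'(x_2^*-)=-\frac{\mu}{U_*-c}\,y(x_2^* )$. Here $U_+(0)=0$ and $U_+'(0)=\mu$. *)

theory Defs
  imports "HOL-Analysis.Analysis" "HOL-Library.Landau_Symbols"
begin

definition U_plus :: "real \<Rightarrow> real \<Rightarrow> real \<Rightarrow> real" where
  "U_plus \<mu> xs x = (if x \<le> xs then \<mu> * x else \<mu> * xs)"

definition U_profile :: "real \<Rightarrow> real \<Rightarrow> real \<Rightarrow> real" where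
  "U_profile \<mu> xs x = (if x < 0 then 0 else U_plus \<mu> xs x)"

text \<open>Membership in $C^{0,1}(\mathbb{R})$, read as finiteness of the full norm
  (sup norm plus Lipschitz seminorm).\<close>
definition C01 :: "(real \<Rightarrow> real) \<Rightarrow> bool" where
  "C01 f \<longleftrightarrow> bounded (range f) \<and> (\<exists>L. L-lipschitz_on UNIV f)"

text \<open>The Rayleigh equation $-y'' + (U_+''/(U_+ - c) + k^2) y = 0$ on $(0,\infty)$ for
  $U_+ = $ \<^term>\<open>U_plus \<mu> xs\<close>. Since $U_+'' = -\mu\,\delta_{xs}$, it means
  $y'' = k^2 y$ away from $xs$ together with a jump of $y'$ at $xs$.\<close>
definition rayleigh_equation ::
    "real \<Rightarrow> real \<Rightarrow> real \<Rightarrow> complex \<Rightarrow> (real \<Rightarrow> complex) \<Rightarrow> bool" where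
  "rayleigh_equation k \<mu> xs c y \<longleftrightarrow>
     continuous_on {0..} y \<and>
     (\<exists>y' yl yr.
        (\<forall>x \<in> {0<..<xs} \<union> {xs<..}.
           (y has_vector_derivative y' x) (at x) \<and>
           (y' has_vector_derivative (of_real (k\<^sup>2) * y x)) (at x)) \<and>
        (y' \<longlongrightarrow> yl) (at_left xs) \<and> (y' \<longlongrightarrow> yr) (at_right xs) \<and>
        yr - yl = - (of_real \<mu> / (of_real (U_plus \<mu> xs xs) - c)) * y xs)"

text \<open>The dispersion relation at the interface, with $\sigma = 0$ and $h_\pm = \infty$;
  $y'(0)$ and $U_+'(0)$ are one-sided derivatives, required to exist.\<close>
definition interface_condition ::
    "real \<Rightarrow> real \<Rightarrow> real \<Rightarrow> (real \<Rightarrow> real) \<Rightarrow> complex \<Rightarrow> (real \<Rightarrow> complex) \<Rightarrow> bool" where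
  "interface_condition g k \<epsilon> U c y \<longleftrightarrow>
     (\<exists>dy dU.
        (y has_vector_derivative dy) (at 0 within {0..}) \<and>
        (U has_real_derivative dU) (at 0 within {0..}) \<and>
        of_real (g * (1 - \<epsilon>)) =
          - of_real \<epsilon> * (of_real (U 0) - c)\<^sup>2 * dy + c\<^sup>2 * of_real k
          + of_real \<epsilon> * of_real dU * (of_real (U 0) - c))"

definition unstable_mode ::
    "real \<Rightarrow> real \<Rightarrow> real \<Rightarrow> real \<Rightarrow> real \<Rightarrow> complex \<Rightarrow> (real \<Rightarrow> complex) \<Rightarrow> bool" where
  "unstable_mode g k \<mu> xs \<epsilon> c y \<longleftrightarrow>
     rayleigh_equation k \<mu> xs c y \<and> y 0 = 1 \<and> (y \<longlongrightarrow> 0) at_top \<and>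
     interface_condition g k \<epsilon> (U_plus \<mu> xs) c y \<and> 0 < Im c"

text \<open>An inflection point is a point where the (classical) second derivative exists and
  vanishes; no change of sign is required.\<close>
definition inflection_point :: "(real \<Rightarrow> real) \<Rightarrow> real \<Rightarrow> bool" where
  "inflection_point f x \<longleftrightarrow>
     (\<exists>f'. (\<forall>\<^sub>F t in nhds x. (f has_real_derivative f' t) (at t)) \<and>
           (f' has_real_derivative 0) (at x))"

end

theory Submission
  imports Defs
begin

text \<open>Solving the Rayleigh equation explicitly on both sides of the kink turns the dispersion
  relation into a real cubic in $c$. The parameters are tuned so that for $\epsilon = 0$ this cubic
  is $k (c - c_0)^2 (c + c_0)$ with $c_0 = \sqrt{g/k}$. For small $\epsilon > 0$ it is positive on
  $[0,\infty)$ while the sum of its roots stays positive, so its roots cannot all be real; the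
  value $O(\epsilon)$ of the cubic at $c_0$ controls $(\mathrm{Im}\, c)^2$.\<close>

section \<open>Cubics with a pair of non-real roots\<close>

text \<open>The intermediate value theorem yields a root \<open>r < 0\<close>; dividing it out
  leaves a quadratic whose vertex lies at a positive abscissa, because \<open>a2 \<le> 0\<close>. If
  that quadratic had real roots, the larger one would be positive, against \<open>pos\<close>. The
  last conclusion is what turns the size of \<open>f\<close> at a single nonnegative point into a
  bound on the imaginary part.\<close>

lemma cubic_complex_root:
  fixes a3 a2 a1 a0 M :: real
  defines "f \<equiv> \<lambda>x. a3 * x^3 + a2 * x\<^sup>2 + a1 * x + a0"
  assumes a3: "a3 > 0" and a2: "a2 \<le> 0"
    and pos: "\<And>x. x \<ge> 0 \<Longrightarrow> f x > 0"
    and M: "M > 0" "f (- M) \<le> 0"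
  obtains c :: complex where "Im c > 0"
    "of_real a3 * c^3 + of_real a2 * c\<^sup>2 + of_real a1 * c + of_real a0 = 0"
    "\<And>x. x \<ge> 0 \<Longrightarrow> a3 * x * (Im c)\<^sup>2 \<le> f x"
proof -
  have "\<exists>r. - M \<le> r \<and> r \<le> 0 \<and> f r = 0"
    using M pos[of 0] unfolding f_def
    by (intro IVT') (auto intro!: continuous_intros)
  then obtain r where r: "r \<le> 0" "f r = 0" by blast
  with pos[of 0] have r0: "r < 0" by (cases "r = 0") auto
  define b where "b = a2 + a3 * r"
  define d where "d = a1 + b * r"
  have a0: "a0 = - d * r"
    using r(2) unfolding f_def d_def b_def by (simp add: algebra_simps power2_eq_square power3_eq_cube)
  have fac: "f x = (x - r) * (a3 * x\<^sup>2 + b * x + d)" for x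
    unfolding f_def a0 d_def b_def by (simp add: algebra_simps power2_eq_square power3_eq_cube)
  have b: "b < 0" using a2 a3 r0 by (simp add: b_def add_nonpos_neg mult_pos_neg)
  \<comment> \<open>Minus the discriminant of the quadratic factor. If it were nonpositive, the
    larger root \<open>w\<close> would be real and, since \<open>b < 0\<close>, nonnegative.\<close>
  define D where "D = 4 * a3 * d - b\<^sup>2"
  have D: "D > 0"
  proof (rule ccontr)
    assume "\<not> D > 0"
    define w where "w = (- b + sqrt (- D)) / (2 * a3)"
    have "a3 * w\<^sup>2 + b * w + d = ((2 * a3 * w + b)\<^sup>2 + D) / (4 * a3)"
      using a3 by (simp add: D_def field_simps power2_eq_square)
    also have "2 * a3 * w + b = sqrt (- D)" using a3 by (simp add: w_def)
    finally have "f w = 0" using \<open>\<not> D > 0\<close> by (simp add: fac)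
    moreover have "w \<ge> 0" unfolding w_def using b a3 \<open>\<not> D > 0\<close>
      by (intro divide_nonneg_pos add_nonneg_nonneg) auto
    ultimately show False using pos[of w] by simp
  qed
  define u v where "u = - b / (2 * a3)" and "v = sqrt D / (2 * a3)"
  have v: "v > 0" using D a3 by (simp add: v_def)
  have b': "b = - 2 * a3 * u" using a3 by (simp add: u_def)
  have "4 * a3\<^sup>2 * v\<^sup>2 = D" using D a3 by (simp add: v_def power_divide power_mult_distrib)
  then have "4 * a3 * d = 4 * a3 * (a3 * (u\<^sup>2 + v\<^sup>2))"
    by (simp add: D_def b' algebra_simps power2_eq_square)
  then have d': "d = a3 * (u\<^sup>2 + v\<^sup>2)" using a3 by simp
  have sq: "f x = (x - r) * (a3 * ((x - u)\<^sup>2 + v\<^sup>2))" for x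
    unfolding fac b' d' by (simp add: algebra_simps power2_eq_square)
  show ?thesis
  proof (rule that[of "Complex u v"])
    let ?c = "Complex u v"
    have q: "of_real a3 * ?c\<^sup>2 + of_real b * ?c + of_real d = 0"
      unfolding b' d' by (simp add: complex_eq_iff power2_eq_square algebra_simps)
    have "of_real a3 * ?c^3 + of_real a2 * ?c\<^sup>2 + of_real a1 * ?c + of_real a0
        = (?c - of_real r) * (of_real a3 * ?c\<^sup>2 + of_real b * ?c + of_real d)"
      unfolding a0 d_def b_def by (simp add: algebra_simps power2_eq_square power3_eq_cube)
    then show "of_real a3 * ?c^3 + of_real a2 * ?c\<^sup>2 + of_real a1 * ?c + of_real a0 = 0"
      by (simp add: q)
    show "a3 * x * (Im ?c)\<^sup>2 \<le> f x" if "x \<ge> 0" for x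
    proof -
      \<comment> \<open>Both \<open>- r\<close> and the square \<open>(x - u)^2\<close> are dropped
        from the factorization \<open>sq\<close>.\<close>
      have "x * (a3 * v\<^sup>2) \<le> (x - r) * (a3 * ((x - u)\<^sup>2 + v\<^sup>2))"
        using that a3 r0 by (intro mult_mono) auto
      then show ?thesis by (simp add: sq mult_ac)
    qed
  qed (use v in simp)
qed

lemma quadratic_pos:
  fixes A B C t :: real
  assumes "A > 0" "B\<^sup>2 < 4 * A * C"
  shows "A * t\<^sup>2 + B * t + C > 0"
proof -
  have "A * t\<^sup>2 + B * t + C = ((2 * A * t + B)\<^sup>2 + (4 * A * C - B\<^sup>2)) / (4 * A)"
    using assms(1) by (simp add: field_simps power2_eq_square)
  also have "\<dots> > 0" using assms by (intro divide_pos_pos add_nonneg_pos) auto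
  finally show ?thesis .
qed

text \<open>Written in \<open>t = x - c0\<close>, the double root contributes at least
  \<open>k * c0 * t^2\<close>, while the perturbation is positive at \<open>t = 0\<close>, with
  value \<open>\<epsilon> * \<kappa> * c0^2\<close>. The linear term
  \<open>\<epsilon> * m * t\<close> is harmless: its square is of order \<open>\<epsilon>^2\<close>,
  whereas the product of the outer coefficients is of order \<open>\<epsilon>\<close>. Here
  \<open>e1\<close> keeps half of the quadratic coefficient and \<open>e2\<close> is the resulting
  discriminant condition.\<close>

lemma perturbed_cubic_pos:
  fixes k c0 \<mu> \<kappa> \<epsilon> x :: real
  assumes "k > 0" "c0 > 0" "\<mu> > 0" "\<kappa> > 0" "\<epsilon> > 0" "x \<ge> 0"
    and e1: "\<epsilon> * (\<mu> + \<kappa>) \<le> k * c0 / 2"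
    and e2: "\<epsilon> * (2 * k * c0\<^sup>2 - \<mu> * c0)\<^sup>2 < k * c0 * \<kappa> * c0\<^sup>2"
  shows "k * (x - c0)\<^sup>2 * (x + c0) + \<epsilon> * (k * x\<^sup>2 - \<mu> * x + k * c0\<^sup>2) * (x - c0) + \<epsilon> * \<kappa> * x\<^sup>2 > 0"
proof -
  define m t where "m = 2 * k * c0\<^sup>2 - \<mu> * c0" and "t = x - c0"
  have x: "x = c0 + t" by (simp add: t_def)
  have "0 < (k * c0 / 2) * t\<^sup>2 + (\<epsilon> * m) * t + \<epsilon> * \<kappa> * c0\<^sup>2 / 2"
  proof (rule quadratic_pos)
    have "\<epsilon> * (\<epsilon> * m\<^sup>2) < \<epsilon> * (k * c0 * \<kappa> * c0\<^sup>2)"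
      using e2 assms unfolding m_def by (intro mult_strict_left_mono) auto
    then show "(\<epsilon> * m)\<^sup>2 < 4 * (k * c0 / 2) * (\<epsilon> * \<kappa> * c0\<^sup>2 / 2)"
      by (simp add: power2_eq_square algebra_simps)
  qed (use assms in simp)
  also have "\<dots> \<le> (k * c0 - \<epsilon> * (\<mu> + \<kappa>)) * t\<^sup>2 + \<epsilon> * m * t + \<epsilon> * \<kappa> * c0\<^sup>2 / 2"
    by (intro add_right_mono mult_right_mono) (use e1 in linarith, simp)
  also have "\<dots> = (k * c0 - \<epsilon> * \<mu>) * t\<^sup>2 + \<epsilon> * m * t + \<epsilon> * \<kappa> * (c0\<^sup>2 / 2 - t\<^sup>2)"
    by (simp add: algebra_simps)
  also have "\<dots> \<le> (k * c0 - \<epsilon> * \<mu>) * t\<^sup>2 + \<epsilon> * m * t + \<epsilon> * \<kappa> * x\<^sup>2"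
  proof -
    \<comment> \<open>Replaces \<open>x^2\<close> by a constant at the price of a multiple of
      \<open>t^2\<close>, which the double root absorbs.\<close>
    have "x\<^sup>2 - (c0\<^sup>2 / 2 - t\<^sup>2) = (c0 + 2 * t)\<^sup>2 / 2"
      by (simp add: x power2_eq_square field_simps)
    then have "c0\<^sup>2 / 2 - t\<^sup>2 \<le> x\<^sup>2" by (smt (verit) zero_le_power2 divide_nonneg_pos)
    then show ?thesis using assms by (intro add_left_mono mult_left_mono) auto
  qed
  also have "\<dots> \<le> (k * (x + c0) + \<epsilon> * (k * (x + c0) - \<mu>)) * t\<^sup>2 + \<epsilon> * m * t + \<epsilon> * \<kappa> * x\<^sup>2"
  proof -
    have "k * c0 \<le> k * (x + c0)" "0 \<le> \<epsilon> * (k * (x + c0))" using assms by auto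
    then show ?thesis by (intro add_right_mono mult_right_mono) (auto simp: algebra_simps)
  qed
  also have "\<dots> = k * (x - c0)\<^sup>2 * (x + c0) + \<epsilon> * (k * x\<^sup>2 - \<mu> * x + k * c0\<^sup>2) * (x - c0) + \<epsilon> * \<kappa> * x\<^sup>2"
    by (simp add: x m_def power2_eq_square algebra_simps)
  finally show ?thesis .
qed

text \<open>The equation below is the dispersion relation after inserting
  $y'(0) = -k + \kappa / (c_0 - c)$ and multiplying by $c - c_0$.\<close>
lemma dispersion_root:
  fixes k c0 \<mu> \<kappa> \<epsilon> :: real
  assumes "k > 0" "c0 > 0" "\<kappa> > 0" "\<kappa> < \<mu>" "\<epsilon> > 0"
    and e1: "\<epsilon> * (\<mu> + \<kappa>) \<le> k * c0 / 2"
    and e2: "\<epsilon> * (2 * k * c0\<^sup>2 - \<mu> * c0)\<^sup>2 < k * c0 * \<kappa> * c0\<^sup>2"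
  obtains c :: complex where "Im c > 0"
    "(c - of_real c0) * (of_real (k * (1 + \<epsilon>)) * c\<^sup>2 - of_real (\<epsilon> * \<mu>) * c
       - of_real (k * c0\<^sup>2 * (1 - \<epsilon>))) + of_real (\<epsilon> * \<kappa>) * c\<^sup>2 = 0"
    "(Im c)\<^sup>2 \<le> \<epsilon> * (\<kappa> * c0 / k)"
proof -
  define a3 a2 a1 a0 where "a3 = k * (1 + \<epsilon>)" and "a2 = - k * (1 + \<epsilon>) * c0 - \<epsilon> * \<mu> + \<epsilon> * \<kappa>"
    and "a1 = \<epsilon> * \<mu> * c0 - k * c0\<^sup>2 * (1 - \<epsilon>)" and "a0 = k * c0\<^sup>2 * (1 - \<epsilon>) * c0"
  note a_defs = a3_def a2_def a1_def a0_def
  define f where "f = (\<lambda>x. a3 * x^3 + a2 * x\<^sup>2 + a1 * x + a0)"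
  have f: "f x = k * (x - c0)\<^sup>2 * (x + c0) + \<epsilon> * (k * x\<^sup>2 - \<mu> * x + k * c0\<^sup>2) * (x - c0) + \<epsilon> * \<kappa> * x\<^sup>2" for x
    by (simp add: f_def a_defs power2_eq_square power3_eq_cube algebra_simps)
  \<comment> \<open>The unperturbed cubic has its negative root at \<open>- c0\<close>. At
    \<open>- 2 * c0\<close> it equals \<open>- 9 * k * c0^3\<close>, enough to outweigh the only
    positive perturbation term, \<open>4 * \<epsilon> * \<kappa> * c0^2\<close>.\<close>
  have "f (- (2 * c0)) = c0\<^sup>2 * (4 * \<epsilon> * \<kappa> - 9 * (k * c0)) - 3 * c0 * \<epsilon> * (5 * k * c0\<^sup>2 + 2 * \<mu> * c0)"
    by (simp add: f power2_eq_square algebra_simps)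
  moreover have "c0\<^sup>2 * (4 * \<epsilon> * \<kappa> - 9 * (k * c0)) \<le> 0"
  proof (rule mult_nonneg_nonpos)
    have "\<epsilon> * \<kappa> \<le> \<epsilon> * (\<mu> + \<kappa>)" "k * c0 > 0" using assms by auto
    with e1 show "4 * \<epsilon> * \<kappa> - 9 * (k * c0) \<le> 0" by argo
  qed simp
  moreover have "3 * c0 * \<epsilon> * (5 * k * c0\<^sup>2 + 2 * \<mu> * c0) \<ge> 0" using assms by simp
  ultimately have neg: "f (- (2 * c0)) \<le> 0" by linarith
  have a2: "a2 \<le> 0"
  proof -
    have "\<epsilon> * \<kappa> \<le> \<epsilon> * \<mu>" "k * (1 + \<epsilon>) * c0 > 0" using assms by auto
    then show ?thesis by (simp add: a2_def)
  qed
  have pos: "f x > 0" if "x \<ge> 0" for x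
    unfolding f using perturbed_cubic_pos[of k c0 \<mu> \<kappa> \<epsilon> x] assms that by simp
  obtain c :: complex where c: "Im c > 0"
    "of_real a3 * c^3 + of_real a2 * c\<^sup>2 + of_real a1 * c + of_real a0 = 0"
    "\<And>x. x \<ge> 0 \<Longrightarrow> a3 * x * (Im c)\<^sup>2 \<le> a3 * x^3 + a2 * x\<^sup>2 + a1 * x + a0"
  proof (rule cubic_complex_root)
    show "a3 > 0" using assms by (simp add: a3_def)
    show "a2 \<le> 0" by (rule a2)
    show "2 * c0 > 0" using assms by simp
    show "a3 * (- (2 * c0))^3 + a2 * (- (2 * c0))\<^sup>2 + a1 * (- (2 * c0)) + a0 \<le> 0"
      using neg unfolding f_def .
    show "a3 * x^3 + a2 * x\<^sup>2 + a1 * x + a0 > 0" if "x \<ge> 0" for x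
      using pos[OF that] unfolding f_def .
  qed blast
  show ?thesis
  proof (rule that[OF c(1)])
    show "(c - of_real c0) * (of_real (k * (1 + \<epsilon>)) * c\<^sup>2 - of_real (\<epsilon> * \<mu>) * c
       - of_real (k * c0\<^sup>2 * (1 - \<epsilon>))) + of_real (\<epsilon> * \<kappa>) * c\<^sup>2 = 0"
      using c(2) by (simp add: a_defs power2_eq_square power3_eq_cube algebra_simps)
    \<comment> \<open>At \<open>x = c0\<close> the first two terms of \<open>f\<close> vanish and
      only \<open>\<epsilon> * \<kappa> * c0^2\<close> remains. This is the source of the rate
      \<open>sqrt \<epsilon>\<close>.\<close>
    have "k * c0 * (Im c)\<^sup>2 \<le> a3 * c0 * (Im c)\<^sup>2"
      using assms by (intro mult_right_mono) (auto simp: a3_def)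
    also have "\<dots> \<le> \<epsilon> * \<kappa> * c0\<^sup>2" using c(3)[of c0] f[of c0] assms by (simp add: f_def)
    finally show "(Im c)\<^sup>2 \<le> \<epsilon> * (\<kappa> * c0 / k)"
      using assms by (simp add: field_simps power2_eq_square)
  qed
qed

section \<open>Explicit solution of the Rayleigh equation\<close>

text \<open>The general solution of y'' = k^2 y. Keeping both coefficients as parameters makes
  differentiation act on the coefficients alone.\<close>

definition exp_wave :: "real \<Rightarrow> complex \<Rightarrow> complex \<Rightarrow> real \<Rightarrow> complex" where
  "exp_wave k a b x = exp (k * x) *\<^sub>R a + exp (- k * x) *\<^sub>R b"

lemma exp_wave_has_vector_derivative:
  "(exp_wave k a b has_vector_derivative exp_wave k (k *\<^sub>R a) (- k *\<^sub>R b) x) (at x within S)"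
  unfolding exp_wave_def[abs_def]
  by (auto intro!: derivative_eq_intros simp: algebra_simps)

lemma continuous_on_exp_wave: "continuous_on S (exp_wave k a b)"
  unfolding exp_wave_def[abs_def] by (intro continuous_intros)

lemma exp_wave_tendsto: "(exp_wave k a b \<longlongrightarrow> exp_wave k a b x) (at x within S)"
  using continuous_on_exp_wave[of UNIV k a b]
  by (meson UNIV_I continuous_on_def subset_UNIV tendsto_within_subset)

text \<open>This is e^(-kx) + \<beta> (e^(-k|x - xs|) - e^(-k(x + xs))): the decaying wave plus a
  multiple of the Dirichlet Green function of the half-line with source at the kink. Hence y(0) = 1,
  decay and continuity hold for every \<beta>, and y' jumps by -2k\<beta> at
  \<open>xs\<close>.\<close>

definition rayleigh_mode :: "real \<Rightarrow> real \<Rightarrow> complex \<Rightarrow> real \<Rightarrow> complex" where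
  "rayleigh_mode k xs \<beta> x =
     (if x \<le> xs then exp_wave k (exp (- k * xs) *\<^sub>R \<beta>) (1 - exp (- k * xs) *\<^sub>R \<beta>) x
      else exp_wave k 0 (1 - exp (- k * xs) *\<^sub>R \<beta> + exp (k * xs) *\<^sub>R \<beta>) x)"

lemma rayleigh_mode_0: "xs > 0 \<Longrightarrow> rayleigh_mode k xs \<beta> 0 = 1"
  by (simp add: rayleigh_mode_def exp_wave_def)

lemma rayleigh_mode_tendsto_0:
  assumes "k > 0"
  shows "(rayleigh_mode k xs \<beta> \<longlongrightarrow> 0) at_top"
proof (rule Lim_transform_eventually)
  define b where "b = 1 - exp (- k * xs) *\<^sub>R \<beta> + exp (k * xs) *\<^sub>R \<beta>"
  have "filterlim (\<lambda>x. - k * x) at_bot at_top"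
    by (rule filterlim_tendsto_neg_mult_at_bot[OF tendsto_const]) (use assms in \<open>auto simp: filterlim_ident\<close>)
  then have "((\<lambda>x. exp (- k * x)) \<longlongrightarrow> 0) at_top"
    by (rule filterlim_compose[OF exp_at_bot])
  from tendsto_scaleR[OF this tendsto_const[of b]]
  show "(exp_wave k 0 b \<longlongrightarrow> 0) at_top" by (simp add: exp_wave_def[abs_def])
  show "\<forall>\<^sub>F x in at_top. exp_wave k 0 b x = rayleigh_mode k xs \<beta> x"
    using eventually_gt_at_top[of xs] by eventually_elim (simp add: rayleigh_mode_def b_def)
qed

lemma rayleigh_mode_derivative_0:
  assumes "xs > 0"
  shows "(rayleigh_mode k xs \<beta> has_vector_derivative
           of_real (- k) + of_real (2 * k * exp (- k * xs)) * \<beta>) (at 0 within {0..})"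
proof (rule has_vector_derivative_transform_within)
  let ?a = "exp (- k * xs) *\<^sub>R \<beta>"
  show "(exp_wave k ?a (1 - ?a) has_vector_derivative
          of_real (- k) + of_real (2 * k * exp (- k * xs)) * \<beta>) (at 0 within {0..})"
    using exp_wave_has_vector_derivative[of k ?a "1 - ?a" 0 "{0..}"]
    by (rule has_vector_derivative_eq_rhs) (simp add: exp_wave_def scaleR_conv_of_real algebra_simps)
qed (use assms in \<open>auto simp: rayleigh_mode_def dist_real_def\<close>)

text \<open>The hypothesis on \<beta> is the jump condition multiplied by
  \<open>\<mu> * xs - c\<close>, with y(xs) = e^(-k xs) + \<beta> (1 - e^(-2k xs)) inserted.\<close>

lemma rayleigh_mode_solves:
  fixes k \<mu> xs :: real and c :: complex
  assumes k: "k > 0" and xs: "xs > 0" and c: "Im c > 0"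
    and \<beta>: "\<beta> * (of_real (2 * k * \<mu> * xs - \<mu> * (1 - exp (- 2 * k * xs))) - of_real (2 * k) * c)
           = of_real (\<mu> * exp (- k * xs))"
  shows "rayleigh_equation k \<mu> xs c (rayleigh_mode k xs \<beta>)"
proof -
  define a b1 b2 where "a = exp (- k * xs) *\<^sub>R \<beta>" and "b1 = 1 - a"
    and "b2 = 1 - a + exp (k * xs) *\<^sub>R \<beta>"
  let ?l = "exp_wave k a b1" and ?r = "exp_wave k 0 b2"
  have y: "rayleigh_mode k xs \<beta> = (\<lambda>x. if x \<le> xs then ?l x else ?r x)"
    by (simp add: fun_eq_iff rayleigh_mode_def a_def b1_def b2_def)
  have ee: "exp (k * xs) * exp (- (k * xs)) = 1" by (simp add: exp_minus)
  have ys: "?l xs = of_real (exp (- k * xs)) * (1 - a) + \<beta>"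
    by (simp add: exp_wave_def a_def b1_def scaleR_conv_of_real ee flip: of_real_mult mult.assoc)
  have match: "?l xs = ?r xs"
    unfolding ys by (simp add: exp_wave_def b2_def scaleR_conv_of_real algebra_simps
        flip: of_real_mult mult.assoc) (simp add: ee)
  have cont: "continuous_on {0..} (rayleigh_mode k xs \<beta>)"
  proof -
    have "continuous_on ({..xs} \<union> {xs..}) (rayleigh_mode k xs \<beta>)"
      unfolding y by (intro continuous_on_If continuous_on_exp_wave) (auto simp: match)
    then show ?thesis by (rule continuous_on_subset) auto
  qed
  define l' r' where "l' = exp_wave k (k *\<^sub>R a) (- k *\<^sub>R b1)" and "r' = exp_wave k (k *\<^sub>R 0) (- k *\<^sub>R b2)"
  define y' where "y' = (\<lambda>x. if x \<le> xs then l' x else r' x)"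
  have second: "exp_wave k (k *\<^sub>R k *\<^sub>R p) (- k *\<^sub>R - k *\<^sub>R q) x = of_real (k\<^sup>2) * exp_wave k p q x" for p q x
    by (simp add: exp_wave_def scaleR_conv_of_real power2_eq_square algebra_simps)
  have der: "(rayleigh_mode k xs \<beta> has_vector_derivative y' x) (at x) \<and>
        (y' has_vector_derivative (of_real (k\<^sup>2) * rayleigh_mode k xs \<beta> x)) (at x)"
    if x: "x \<in> {0<..<xs} \<union> {xs<..}" for x
  proof (cases "x < xs")
    case True
    have "(?l has_vector_derivative l' x) (at x)"
      unfolding l'_def by (rule exp_wave_has_vector_derivative)
    then have 1: "(rayleigh_mode k xs \<beta> has_vector_derivative l' x) (at x)"
      by (rule has_vector_derivative_transform_within_open[of _ _ _ "{..<xs}"]) (use True in \<open>auto simp: y\<close>)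
    have "(l' has_vector_derivative of_real (k\<^sup>2) * ?l x) (at x)"
      unfolding l'_def second[symmetric] by (rule exp_wave_has_vector_derivative)
    then have 2: "(y' has_vector_derivative of_real (k\<^sup>2) * ?l x) (at x)"
      by (rule has_vector_derivative_transform_within_open[of _ _ _ "{..<xs}"]) (use True in \<open>auto simp: y'_def\<close>)
    show ?thesis using 1 2 True by (simp add: y'_def y)
  next
    case False
    with x have xx: "x > xs" by auto
    have "(?r has_vector_derivative r' x) (at x)"
      unfolding r'_def by (rule exp_wave_has_vector_derivative)
    then have 1: "(rayleigh_mode k xs \<beta> has_vector_derivative r' x) (at x)"
      by (rule has_vector_derivative_transform_within_open[of _ _ _ "{xs<..}"]) (use xx in \<open>auto simp: y\<close>)
    have "(r' has_vector_derivative of_real (k\<^sup>2) * ?r x) (at x)"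
      unfolding r'_def second[symmetric] by (rule exp_wave_has_vector_derivative)
    then have 2: "(y' has_vector_derivative of_real (k\<^sup>2) * ?r x) (at x)"
      by (rule has_vector_derivative_transform_within_open[of _ _ _ "{xs<..}"]) (use xx in \<open>auto simp: y'_def\<close>)
    show ?thesis using 1 2 xx by (simp add: y'_def y)
  qed
  have lim_l: "(y' \<longlongrightarrow> l' xs) (at_left xs)"
    by (rule Lim_transform_eventually[of l'])
      (auto simp: l'_def y'_def eventually_at_filter intro!: exp_wave_tendsto)
  have lim_r: "(y' \<longlongrightarrow> r' xs) (at_right xs)"
    by (rule Lim_transform_eventually[of r'])
      (auto simp: r'_def y'_def eventually_at_filter intro!: exp_wave_tendsto)
  have "of_real (exp (k * xs)) * of_real (exp (- k * xs)) = (1 :: complex)"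
    by (simp add: ee flip: of_real_mult)
  moreover have "r' xs - l' xs
      = - of_real (2 * k) * (of_real (exp (k * xs)) * of_real (exp (- k * xs))) * \<beta>"
    by (simp add: l'_def r'_def exp_wave_def a_def b1_def b2_def scaleR_conv_of_real algebra_simps)
  ultimately have jump: "r' xs - l' xs = - of_real (2 * k) * \<beta>" by simp
  define W :: complex where "W = of_real (\<mu> * xs) - c"
  \<comment> \<open>A non-real \<open>c\<close> cannot equal the real velocity at the kink.\<close>
  have W: "W \<noteq> 0" using c by (auto simp: W_def complex_eq_iff)
  have "exp (- 2 * k * xs) = exp (- k * xs) * exp (- k * xs)"
    by (simp flip: exp_add)
  then have "of_real (2 * k) * \<beta> * W = of_real \<mu> * (of_real (exp (- k * xs)) * (1 - a) + \<beta>)"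
    using \<beta> by (simp add: W_def a_def scaleR_conv_of_real algebra_simps)
  then have "- of_real (2 * k) * \<beta> = - (of_real \<mu> / W) * ?l xs"
    using W by (simp add: ys field_simps)
  then have "r' xs - l' xs = - (of_real \<mu> / (of_real (U_plus \<mu> xs xs) - c)) * rayleigh_mode k xs \<beta> xs"
    by (simp add: jump W_def U_plus_def y)
  with cont der lim_l lim_r show ?thesis unfolding rayleigh_equation_def by blast
qed

section \<open>From a root of the cubic to an unstable mode\<close>

lemma U_plus_derivative_0:
  assumes "xs > 0"
  shows "(U_plus \<mu> xs has_real_derivative \<mu>) (at 0 within {0..})"
proof (rule DERIV_subset[OF has_field_derivative_transform_within_open[of "\<lambda>x. \<mu> * x" _ _ "{..<xs}"]])
  show "((\<lambda>x. \<mu> * x) has_real_derivative \<mu>) (at 0)" by (auto intro!: derivative_eq_intros)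
qed (use assms in \<open>auto simp: U_plus_def\<close>)

text \<open>Solving the jump condition for \<beta> gives a simple pole in \<open>c\<close>; the
  hypothesis \<open>c0\<close> places it at \<open>c0\<close>. The root equation is then the
  interface condition cleared of this pole.\<close>

lemma unstable_mode_from_root:
  fixes k g c0 \<mu> xs \<epsilon> :: real and c :: complex
  defines "\<kappa> \<equiv> \<mu> * exp (- 2 * k * xs)"
  assumes k: "k > 0" and xs: "xs > 0" and c: "Im c > 0" and g: "g = k * c0\<^sup>2"
    and c0: "2 * k * c0 = 2 * k * \<mu> * xs - \<mu> * (1 - exp (- 2 * k * xs))"
    and root: "(c - of_real c0) * (of_real (k * (1 + \<epsilon>)) * c\<^sup>2 - of_real (\<epsilon> * \<mu>) * c
       - of_real (k * c0\<^sup>2 * (1 - \<epsilon>))) + of_real (\<epsilon> * \<kappa>) * c\<^sup>2 = 0"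
  shows "unstable_mode g k \<mu> xs \<epsilon> c
           (rayleigh_mode k xs (of_real (\<mu> * exp (- k * xs)) / (of_real (2 * k) * (of_real c0 - c))))"
proof -
  define V where "V = of_real c0 - c"
  define \<beta> where "\<beta> = of_real (\<mu> * exp (- k * xs)) / (of_real (2 * k) * V)"
  have V: "V \<noteq> 0" using c by (auto simp: V_def complex_eq_iff)
  have ray: "rayleigh_equation k \<mu> xs c (rayleigh_mode k xs \<beta>)"
  proof (rule rayleigh_mode_solves[OF k xs c], unfold c0[symmetric])
    show "\<beta> * (of_real (2 * k * c0) - of_real (2 * k) * c) = of_real (\<mu> * exp (- k * xs))"
      using k V by (simp add: \<beta>_def V_def field_simps)
  qed
  define dy :: complex where "dy = of_real (- k) + of_real (2 * k * exp (- k * xs)) * \<beta>"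
  have "exp (- 2 * k * xs) = exp (- k * xs) * exp (- k * xs)" by (simp flip: exp_add)
  \<comment> \<open>That is, y'(0) = -k + \<open>\<kappa> / (c0 - c)\<close>.\<close>
  then have dy: "dy * V = of_real \<kappa> - of_real k * V"
    using k V by (simp add: dy_def \<beta>_def \<kappa>_def field_simps)
  have "(of_real (k * c0\<^sup>2 * (1 - \<epsilon>))) * V =
      (- of_real \<epsilon> * c\<^sup>2 * dy + c\<^sup>2 * of_real k - of_real \<epsilon> * of_real \<mu> * c) * V"
  proof -
    have "(- of_real \<epsilon> * c\<^sup>2 * dy + c\<^sup>2 * of_real k - of_real \<epsilon> * of_real \<mu> * c) * V =
      - of_real \<epsilon> * c\<^sup>2 * (dy * V) + (c\<^sup>2 * of_real k - of_real \<epsilon> * of_real \<mu> * c) * V"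
      by (simp add: algebra_simps)
    also have "\<dots> = of_real (k * c0\<^sup>2 * (1 - \<epsilon>)) * V"
      using root unfolding dy by (simp add: V_def algebra_simps)
    finally show ?thesis ..
  qed
  then have disp: "of_real (g * (1 - \<epsilon>)) =
      - of_real \<epsilon> * (of_real (U_plus \<mu> xs 0) - c)\<^sup>2 * dy + c\<^sup>2 * of_real k
          + of_real \<epsilon> * of_real \<mu> * (of_real (U_plus \<mu> xs 0) - c)"
    using V xs by (simp add: g U_plus_def)
  have "interface_condition g k \<epsilon> (U_plus \<mu> xs) c (rayleigh_mode k xs \<beta>)"
    unfolding interface_condition_def
    using rayleigh_mode_derivative_0[OF xs, of k \<beta>, folded dy_def] U_plus_derivative_0[OF xs, of \<mu>] disp
    by blast
  then show ?thesis
    using ray c rayleigh_mode_0[OF xs] rayleigh_mode_tendsto_0[OF k]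
    by (simp add: unstable_mode_def \<beta>_def V_def)
qed

section \<open>Regularity and inflection points of the profile\<close>

lemma C01_U_profile:
  assumes "\<mu> > 0" "xs > 0"
  shows "C01 (U_profile \<mu> xs)"
  unfolding C01_def
proof
  \<comment> \<open>As a scaled clamp onto the interval from 0 to \<open>xs\<close>, the profile is
    visibly bounded and \<open>\<mu>\<close>-Lipschitz.\<close>
  have U: "U_profile \<mu> xs x = \<mu> * max 0 (min x xs)" for x
    using assms by (auto simp: U_profile_def U_plus_def)
  show "bounded (range (U_profile \<mu> xs))"
    by (rule bounded_subset[of "{0..\<mu> * xs}"]) (use assms in \<open>auto simp: U\<close>)
  have "\<mu>-lipschitz_on UNIV (U_profile \<mu> xs)"
  proof (rule lipschitz_onI)
    fix x y :: real
    have "\<bar>max 0 (min x xs) - max 0 (min y xs)\<bar> \<le> \<bar>x - y\<bar>" by linarith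
    then show "dist (U_profile \<mu> xs x) (U_profile \<mu> xs y) \<le> \<mu> * dist x y"
      using assms by (simp add: U dist_real_def abs_mult flip: right_diff_distrib)
  qed (use assms in simp)
  then show "\<exists>L. L-lipschitz_on UNIV (U_profile \<mu> xs)" by blast
qed

lemma inflection_point_U_profile:
  assumes "0 < x" "x < xs"
  shows "inflection_point (U_profile \<mu> xs) x"
  unfolding inflection_point_def
proof (intro exI conjI)
  have "(U_profile \<mu> xs has_real_derivative \<mu>) (at t)" if "t \<in> {0<..<xs}" for t
  proof (rule has_field_derivative_transform_within_open[of "\<lambda>x. \<mu> * x" _ _ "{0<..<xs}"])
    show "((\<lambda>x. \<mu> * x) has_real_derivative \<mu>) (at t)" by (auto intro!: derivative_eq_intros)
  qed (use that in \<open>auto simp: U_profile_def U_plus_def\<close>)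
  then show "\<forall>\<^sub>F t in nhds x. (U_profile \<mu> xs has_real_derivative (\<lambda>_. \<mu>) t) (at t)"
    using assms by (intro eventually_nhds_in_open[of "{0<..<xs}", THEN eventually_mono]) auto
qed simp

section \<open>Choice of parameters and assembly\<close>

lemma eventually_at_right_mult_less:
  fixes A B :: real
  assumes "B > 0"
  shows "\<forall>\<^sub>F \<epsilon> in at_right 0. \<epsilon> * A < B"
proof -
  have "((\<lambda>\<epsilon>. \<epsilon> * A) \<longlongrightarrow> 0 * A) (at_right 0)" by (intro tendsto_intros)
  then show ?thesis using assms by (auto dest: order_tendstoD)
qed

theorem proposition5p1:
  fixes k g :: real
  assumes "k > 0" and "g > 0"
  shows "\<exists>\<mu> xs. \<mu> > 0 \<and> xs > 0 \<and>
    C01 (U_profile \<mu> xs) \<and>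
    (\<exists>(c :: real \<Rightarrow> complex) (y :: real \<Rightarrow> real \<Rightarrow> complex).
       (\<forall>\<^sub>F \<epsilon> in at_right 0. unstable_mode g k \<mu> xs \<epsilon> (c \<epsilon>) (y \<epsilon>)) \<and>
       (\<lambda>\<epsilon>. Im (c \<epsilon>)) \<in> O[at_right 0](\<lambda>\<epsilon>. sqrt \<epsilon>)) \<and>
    (\<exists>\<delta>>0. U_plus \<mu> xs xs - sqrt (g / k) \<ge> \<delta>) \<and>
    (\<exists>xc. 0 < xc \<and> xc < xs \<and>
       {x. 0 \<le> x \<and> U_plus \<mu> xs x = sqrt (g / k)} = {xc} \<and>
       inflection_point (U_profile \<mu> xs) xc)"
proof -
  define c0 where "c0 = sqrt (g / k)"
  have c0: "c0 > 0" "g = k * c0\<^sup>2" using assms by (auto simp: c0_def)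
  \<comment> \<open>Any positive value would do; only \<open>\<mu>\<close> has to be tuned.\<close>
  define xs :: real where "xs = 1"
  have xs: "xs > 0" by (simp add: xs_def)
  define q where "q = exp (- 2 * k * xs)"
  have q: "q > 0" "q < 1" using assms xs by (auto simp: q_def)
  \<comment> \<open>Strict because \<open>q \<noteq> 1\<close>. As
    \<open>ln q = - 2 * k * xs\<close>, it makes the denominator of \<open>\<mu>\<close>
    positive.\<close>
  have "ln q < q - 1"
    using ln_le_minus_one[of q] ln_eq_minus_one[of q] q by fastforce
  then have s: "2 * k * xs - (1 - q) > 0" by (simp add: q_def)
  \<comment> \<open>This makes the pole of $y'(0)$, as a function of $c$, coincide with $\sqrt{g/k}$.\<close>
  define \<mu> where "\<mu> = 2 * k * c0 / (2 * k * xs - (1 - q))"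
  have \<mu>: "\<mu> > 0" using s c0 assms by (simp add: \<mu>_def)
  have tune: "2 * k * c0 = 2 * k * \<mu> * xs - \<mu> * (1 - exp (- 2 * k * xs))"
  proof -
    have "\<mu> * (2 * k * xs - (1 - q)) = 2 * k * c0" using s by (simp add: \<mu>_def)
    then show ?thesis by (simp add: q_def algebra_simps)
  qed
  \<comment> \<open>The tuning gives this gap as \<open>\<mu> * (1 - q) / (2 * k)\<close>, which
    does not involve \<epsilon>. It serves both as the uniform lower bound and to put the critical
    layer strictly below the kink.\<close>
  have gap: "\<mu> * xs - c0 > 0"
  proof -
    have "2 * k * (\<mu> * xs - c0) = \<mu> * (1 - q)" using tune by (simp add: q_def algebra_simps)
    also have "\<dots> > 0" using \<mu> q by simp
    finally show ?thesis using assms by (simp add: zero_less_mult_iff)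
  qed
  define \<kappa> where "\<kappa> = \<mu> * exp (- 2 * k * xs)"
  have \<kappa>: "\<kappa> > 0" "\<kappa> < \<mu>" using \<mu> q by (auto simp: \<kappa>_def q_def)
  define P where "P = (\<lambda>\<epsilon> c. Im c > 0 \<and> (c - of_real c0) * (of_real (k * (1 + \<epsilon>)) * c\<^sup>2 - of_real (\<epsilon> * \<mu>) * c
       - of_real (k * c0\<^sup>2 * (1 - \<epsilon>))) + of_real (\<epsilon> * \<kappa>) * c\<^sup>2 = 0 \<and> (Im c)\<^sup>2 \<le> \<epsilon> * (\<kappa> * c0 / k))"
  \<comment> \<open>Choice turns the separate roots into one function of \<epsilon>, as the
    O-estimate needs. Its values are controlled only where a root exists, so all later claims are
    eventual.\<close>
  define c where "c = (\<lambda>\<epsilon>. SOME c. P \<epsilon> c)"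
  define y where "y = (\<lambda>\<epsilon>. rayleigh_mode k xs
      (of_real (\<mu> * exp (- k * xs)) / (of_real (2 * k) * (of_real c0 - c \<epsilon>))))"
  have "\<forall>\<^sub>F \<epsilon> in at_right 0. \<epsilon> * (\<mu> + \<kappa>) < k * c0 / 2"
    using assms c0 by (intro eventually_at_right_mult_less) simp
  moreover have "\<forall>\<^sub>F \<epsilon> in at_right 0. \<epsilon> * (2 * k * c0\<^sup>2 - \<mu> * c0)\<^sup>2 < k * c0 * \<kappa> * c0\<^sup>2"
    using assms c0 \<kappa> by (intro eventually_at_right_mult_less) simp
  ultimately have ev: "\<forall>\<^sub>F \<epsilon> in at_right 0. \<epsilon> > 0 \<and> P \<epsilon> (c \<epsilon>)"
    using eventually_at_right_less[of 0]
  proof eventually_elim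
    case (elim \<epsilon>)
    obtain c' where "P \<epsilon> c'"
      unfolding P_def
      by (rule dispersion_root[of k c0 \<kappa> \<mu> \<epsilon>]) (use elim assms c0 \<kappa> in auto)
    then have "\<exists>c. P \<epsilon> c" by blast
    then show ?case using elim by (simp add: c_def someI_ex)
  qed
  have modes: "\<forall>\<^sub>F \<epsilon> in at_right 0. unstable_mode g k \<mu> xs \<epsilon> (c \<epsilon>) (y \<epsilon>)"
    using ev
  proof eventually_elim
    case (elim \<epsilon>)
    then have "Im (c \<epsilon>) > 0"
      "(c \<epsilon> - of_real c0) * (of_real (k * (1 + \<epsilon>)) * (c \<epsilon>)\<^sup>2 - of_real (\<epsilon> * \<mu>) * c \<epsilon>
       - of_real (k * c0\<^sup>2 * (1 - \<epsilon>))) + of_real (\<epsilon> * \<kappa>) * (c \<epsilon>)\<^sup>2 = 0"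
      unfolding P_def by blast+
    then show ?case
      unfolding y_def \<kappa>_def using assms(1) xs c0(2) tune by (intro unstable_mode_from_root)
  qed
  have rate: "(\<lambda>\<epsilon>. Im (c \<epsilon>)) \<in> O[at_right 0](\<lambda>\<epsilon>. sqrt \<epsilon>)"
  proof (rule landau_o.bigI[of "sqrt (\<kappa> * c0 / k)"])
    show "sqrt (\<kappa> * c0 / k) > 0" using \<kappa> c0 assms by simp
    show "\<forall>\<^sub>F \<epsilon> in at_right 0. norm (Im (c \<epsilon>)) \<le> sqrt (\<kappa> * c0 / k) * norm (sqrt \<epsilon>)"
      using ev
    proof eventually_elim
      case (elim \<epsilon>)
      then have "\<bar>Im (c \<epsilon>)\<bar> \<le> sqrt (\<epsilon> * (\<kappa> * c0 / k))"
        by (intro real_le_rsqrt) (simp add: P_def)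
      then show ?case using elim unfolding real_sqrt_mult[of \<epsilon>]
        by (simp add: mult.commute)
    qed
  qed
  define xc where "xc = c0 / \<mu>"
  have xc: "0 < xc" "xc < xs" using c0 \<mu> gap by (auto simp: xc_def field_simps)
  \<comment> \<open>Above the kink \<open>U_plus\<close> is constant and exceeds \<open>c0\<close>
    by \<open>gap\<close>, so the only solution lies on the linear part.\<close>
  have "{x. 0 \<le> x \<and> U_plus \<mu> xs x = c0} = {xc}"
    using gap \<mu> xc by (auto simp: U_plus_def xc_def field_simps split: if_splits)
  then have layer: "{x. 0 \<le> x \<and> U_plus \<mu> xs x = sqrt (g / k)} = {xc}"
    by (simp only: c0_def)
  have bound: "U_plus \<mu> xs xs - sqrt (g / k) \<ge> \<mu> * xs - c0"
    by (simp add: U_plus_def c0_def)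
  show ?thesis
    by (intro exI[of _ \<mu>] exI[of _ xs] exI[of _ c] exI[of _ y] exI[of _ xc]
        exI[of _ "\<mu> * xs - c0"] conjI)
      (fact \<mu> xs modes rate gap bound xc layer C01_U_profile[OF \<mu> xs]
        inflection_point_U_profile[OF xc])+
qed

end
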